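(* Let $q$ be a complex number with $|q|<1$ and let $x$ and $y$ be complex numbers. Then \[ \sum_{j,\,k,\,\ell\,\geq0}\frac{(x^2y^2;q^2)_kx^jy^{2j+2\ell}}{(q;q)_j(q^2;q^2)_k(q^2;q^2)_{\ell}} (-1)^{j+k}q^{(j+k+\ell)(j+k+\ell-1)+\ell^2+3k} =\frac{(q;q^2)_{\infty}}{2(y/q-xy)}\big\{(xy,-y/q;q)_{\infty}-(-xy,y/q;q)_{\infty}\big\}. \]
   Context: For complex $a$ and $|q|<1$, $(a;q)_\infty=\prod_{i=0}^{\infty}(1-aq^i)$, $(a;q)_n=(a;q)_\infty/(aq^n;q)_\infty$ for nonnegative integers $n$, and $(a_1,\dots,a_r;q)_n=(a_1;q)_n\cdots(a_r;q)_n$ (also for $n=\infty$). *)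

theory Defs
  imports "HOL-Analysis.Analysis"
begin

definition qpoch_inf :: "complex \<Rightarrow> complex \<Rightarrow> complex" where
  "qpoch_inf a q = (\<Prod>i. 1 - a * q ^ i)"

text \<open>
  The quotient \<open>(a;q)\<^sub>\<infinity> / (a q\<^sup>n; q)\<^sub>\<infinity>\<close> is \<open>0 / 0\<close> when \<open>a = q\<^sup>-\<^sup>m\<close> with \<open>m \<ge> n\<close>; as usual
  \<open>(a;q)\<^sub>n\<close> then means the finite product that remains after cancelling the common factors.
  Taking that product as the definition covers all \<open>a\<close>; the lemma \<open>qpoch_eq_quotient\<close> below
  shows that it is the quotient whenever the quotient is defined.
\<close>

definition qpoch :: "complex \<Rightarrow> complex \<Rightarrow> nat \<Rightarrow> complex" where
  "qpoch a q n = (\<Prod>i<n. 1 - a * q ^ i)"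

lemma convergent_prod_qpoch:
  fixes a q :: complex
  assumes "norm q < 1"
  shows "convergent_prod (\<lambda>i. 1 - a * q ^ i)"
proof -
  have "summable (\<lambda>i. norm a * norm q ^ i)"
    using assms by (intro summable_mult summable_geometric) simp
  hence "summable (\<lambda>i. norm ((1 - a * q ^ i) - 1))"
    by (simp add: norm_mult norm_power)
  thus ?thesis
    by (intro abs_convergent_prod_imp_convergent_prod summable_imp_abs_convergent_prod)
qed

lemma qpoch_inf_split:
  assumes "norm q < 1"
  shows "qpoch_inf a q = qpoch a q n * qpoch_inf (a * q ^ n) q"
proof -
  let ?f = "\<lambda>i. 1 - a * q ^ i"
  have "(\<lambda>m. \<Prod>i\<le>m. ?f i) \<longlonglongrightarrow> qpoch_inf a q"
    unfolding qpoch_inf_def by (intro convergent_prod_LIMSEQ convergent_prod_qpoch assms)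
  hence 1: "(\<lambda>m. \<Prod>i\<le>m + n. ?f i) \<longlonglongrightarrow> qpoch_inf a q"
    by (rule LIMSEQ_ignore_initial_segment)
  have 2: "(\<lambda>m. qpoch a q n * (\<Prod>i\<le>m. 1 - (a * q ^ n) * q ^ i))
             \<longlonglongrightarrow> qpoch a q n * qpoch_inf (a * q ^ n) q"
    unfolding qpoch_inf_def
    by (intro tendsto_intros convergent_prod_LIMSEQ convergent_prod_qpoch assms)
  have "(\<Prod>i<m + n. ?f i) = (\<Prod>i<n. ?f i) * (\<Prod>i<m. 1 - (a * q ^ n) * q ^ i)" for m
  proof (induction m)
    case (Suc m)
    have "?f (m + n) = 1 - (a * q ^ n) * q ^ m"
      by (simp add: power_add mult_ac)
    with Suc.IH show ?case
      by (simp only: add_Suc prod.lessThan_Suc mult.assoc)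
  qed simp
  from this[of "Suc _"]
  have "(\<Prod>i\<le>m + n. ?f i) = qpoch a q n * (\<Prod>i\<le>m. 1 - (a * q ^ n) * q ^ i)" for m
    by (simp only: qpoch_def add_Suc lessThan_Suc_atMost)
  with 1 2 show ?thesis
    using LIMSEQ_unique by simp
qed

lemma qpoch_eq_quotient:
  assumes "norm q < 1" "qpoch_inf (a * q ^ n) q \<noteq> 0"
  shows "qpoch a q n = qpoch_inf a q / qpoch_inf (a * q ^ n) q"
  using qpoch_inf_split[OF assms(1), of a n] assms(2) by simp

end

theory Submission
  imports Defs
begin

text \<open>
  Put \<open>Q = q\<^sup>2\<close>. The \<open>q\<close>-binomial theorem splits \<open>(x\<^sup>2y\<^sup>2;Q)\<^sub>k / (Q;Q)\<^sub>k\<close> into a sum over \<open>k = m + r\<close>; in the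
  resulting absolutely convergent fourfold series the sum over \<open>r\<close> is an Euler product,
  \<open>(q\<^sup>2\<^sup>M\<^sup>+\<^sup>3;Q)\<^sub>\<infinity> = (q;Q)\<^sub>\<infinity> / (q;Q)\<^sub>M\<^sub>+\<^sub>1\<close> with \<open>M = j + l + m\<close>. What remains, grouped by \<open>M\<close>, is
  \<open>(q;Q)\<^sub>\<infinity> \<Sum>\<^sub>M y\<^sup>2\<^sup>M Q\<^bsup>M choose 2\<^esup> d\<^sub>M / (q;Q)\<^sub>M\<^sub>+\<^sub>1\<close>, where \<open>d\<^sub>M\<close> is the coefficient of \<open>t\<^sup>M\<close> in
  \<open>(-qt, -q\<^sup>3x\<^sup>2t; Q)\<^sub>\<infinity> / (-xt; q)\<^sub>\<infinity>\<close>. On the right-hand side, let \<open>f\<^sub>n\<close> be the coefficient of \<open>t\<^sup>n\<close> in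
  \<open>(xt, -t/q; q)\<^sub>\<infinity>\<close>. The functional equation of that product, applied twice, and that of the
  generating function of \<open>d\<close> give three-term recurrences which show
  \<open>f\<^bsub>2M+1\<^esub> (q;Q)\<^sub>M\<^sub>+\<^sub>1 = (1/q - x) Q\<^bsup>M choose 2\<^esup> d\<^sub>M\<close>.
\<close>

subsection \<open>Euler's series and the \<open>q\<close>-binomial theorem\<close>

lemma qpoch_Suc: "qpoch a q (Suc n) = qpoch a q n * (1 - a * q ^ n)"
  by (simp add: qpoch_def)

lemma qpoch_0 [simp]: "qpoch a q 0 = 1"
  by (simp add: qpoch_def)

text \<open>Every factor satisfies |1 - a q^i| >= 1 - |a|, because |a q^i| <= |a|. Besides
  non-vanishing, this yields the geometric bounds on Euler coefficients used for
  convergence.\<close>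

lemma qpoch_norm_ge:
  assumes "norm a < 1" "norm q \<le> 1"
  shows "(1 - norm a) ^ n \<le> norm (qpoch a q n)"
proof -
  have "1 - norm a \<le> norm (1 - a * q ^ i)" for i
  proof -
    have "norm (a * q ^ i) \<le> norm a"
      using assms by (simp add: norm_mult norm_power mult_left_le power_le_one)
    thus ?thesis
      using norm_triangle_ineq2[of 1 "a * q ^ i"] by simp
  qed
  hence "(\<Prod>i<n. 1 - norm a) \<le> (\<Prod>i<n. norm (1 - a * q ^ i))"
    using assms by (intro prod_mono) auto
  thus ?thesis
    by (simp add: qpoch_def prod_norm)
qed

lemma qpoch_nonzero:
  assumes "norm a < 1" "norm q \<le> 1"
  shows "qpoch a q n \<noteq> 0"
  using qpoch_norm_ge[OF assms, of n] assms(1)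
  by (metis diff_gt_0_iff_gt norm_zero not_less zero_less_power)

lemma choose_two_Suc: "Suc n choose 2 = (n choose 2) + n"
  by (simp add: numeral_2_eq_2)

lemma two_choose_two: "2 * (n choose 2) = n * (n - 1)"
proof (induction n)
  case (Suc n)
  thus ?case
    by (cases n) (simp_all add: choose_two_Suc)
qed simp

section \<open>Functional equations of formal power series under the substitution of cX for
  X\<close>

definition dilate :: "'a :: comm_ring_1 \<Rightarrow> 'a fps \<Rightarrow> 'a fps" where
  "dilate c f = Abs_fps (\<lambda>n. c ^ n * fps_nth f n)"

lemma dilate_nth [simp]: "fps_nth (dilate c f) n = c ^ n * fps_nth f n"
  by (simp add: dilate_def)

lemma dilate_mult: "dilate c (f * g) = dilate c f * dilate c g"
proof (rule fps_ext)
  fix n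
  have "c ^ n * (fps_nth f i * fps_nth g (n - i))
      = (c ^ i * fps_nth f i) * (c ^ (n - i) * fps_nth g (n - i))" if "i \<le> n" for i
    using that by (simp add: mult_ac flip: power_add)
  thus "fps_nth (dilate c (f * g)) n = fps_nth (dilate c f * dilate c g) n"
    by (simp add: fps_mult_nth sum_distrib_left)
qed

lemma dilate_dilate: "dilate c (dilate d f) = dilate (c * d) f"
  by (rule fps_ext) (simp add: power_mult_distrib mult_ac)

abbreviation lin :: "'a :: comm_ring_1 \<Rightarrow> 'a fps" where
  "lin a \<equiv> 1 + fps_const a * fps_X"

lemma lin_mult_nth_0: "fps_nth (lin a * f) 0 = fps_nth f 0"
  by (simp add: algebra_simps)

lemma lin_mult_nth_Suc:
  "fps_nth (lin a * f) (Suc n) = fps_nth f (Suc n) + a * fps_nth f n"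
  by (simp add: distrib_right mult.assoc)

lemmas lin_mult_nth = lin_mult_nth_0 lin_mult_nth_Suc

text \<open>The expansions in \<open>X\<close> of \<open>(aX;q)\<^sub>\<infinity>\<close> and of its reciprocal.\<close>

definition qpoch_fps :: "complex \<Rightarrow> complex \<Rightarrow> complex fps" where
  "qpoch_fps q a = Abs_fps (\<lambda>n. (- a) ^ n * q ^ (n choose 2) / qpoch q q n)"

definition inv_qpoch_fps :: "complex \<Rightarrow> complex \<Rightarrow> complex fps" where
  "inv_qpoch_fps q a = Abs_fps (\<lambda>n. a ^ n / qpoch q q n)"

lemma qpoch_fps_nth: "fps_nth (qpoch_fps q a) n = (- a) ^ n * q ^ (n choose 2) / qpoch q q n"
  by (simp add: qpoch_fps_def)

lemma inv_qpoch_fps_nth: "fps_nth (inv_qpoch_fps q a) n = a ^ n / qpoch q q n"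
  by (simp add: inv_qpoch_fps_def)

lemma qpoch_fps_nth_0 [simp]: "fps_nth (qpoch_fps q a) 0 = 1"
  by (simp add: qpoch_fps_nth numeral_2_eq_2)

lemma inv_qpoch_fps_nth_0 [simp]: "fps_nth (inv_qpoch_fps q a) 0 = 1"
  by (simp add: inv_qpoch_fps_nth)

text \<open>Formal version of (aX;q)_inf = (1 - aX) (aqX;q)_inf, obtained from the coefficients
  alone, without convergence.\<close>

lemma qpoch_fps_dilate:
  assumes "norm q < 1"
  shows "lin (- a) * dilate q (qpoch_fps q a) = qpoch_fps q a"
proof (rule fps_ext)
  fix n
  have nz: "qpoch q q m \<noteq> 0" for m
    using assms by (intro qpoch_nonzero) auto
  show "fps_nth (lin (- a) * dilate q (qpoch_fps q a)) n = fps_nth (qpoch_fps q a) n"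
  proof (cases n)
    case (Suc m)
    have "1 - q * q ^ m \<noteq> 0"
      using nz[of "Suc m"] by (simp add: qpoch_Suc)
    thus ?thesis
      using nz[of m] unfolding Suc lin_mult_nth dilate_nth qpoch_fps_nth qpoch_Suc choose_two_Suc
      by (simp add: divide_simps power_add) (simp add: algebra_simps)
  qed (simp add: lin_mult_nth_0)
qed

lemma inv_qpoch_fps_dilate:
  assumes "norm q < 1"
  shows "dilate q (inv_qpoch_fps q a) = lin (- a) * inv_qpoch_fps q a"
proof (rule fps_ext)
  fix n
  have nz: "qpoch q q m \<noteq> 0" for m
    using assms by (intro qpoch_nonzero) auto
  show "fps_nth (dilate q (inv_qpoch_fps q a)) n = fps_nth (lin (- a) * inv_qpoch_fps q a) n"
  proof (cases n)
    case (Suc m)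
    have "1 - q * q ^ m \<noteq> 0"
      using nz[of "Suc m"] by (simp add: qpoch_Suc)
    thus ?thesis
      using nz[of m] unfolding Suc lin_mult_nth dilate_nth inv_qpoch_fps_nth qpoch_Suc
      by (simp add: divide_simps) (simp add: algebra_simps)
  qed (simp add: lin_mult_nth_0)
qed

lemma one_minus_power_nonzero:
  fixes q :: complex
  assumes "norm q < 1" "n > 0"
  shows "1 - q ^ n \<noteq> 0"
proof
  assume "1 - q ^ n = 0"
  hence "norm (q ^ n) = 1"
    by simp
  thus False
    using assms power_less_one_iff[of "norm q" n] by (simp add: norm_power)
qed

text \<open>The product h(X) = (aX;q)_inf / (X;q)_inf satisfies (1 - aX) h(qX) = (1 - X) h(X).
  Comparing coefficients gives a first-order recurrence, which the quotient on the right also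
  satisfies.\<close>

lemma q_binomial:
  assumes "norm q < 1"
  shows "fps_nth (qpoch_fps q a * inv_qpoch_fps q 1) n = qpoch a q n / qpoch q q n"
proof (induction n)
  case (Suc n)
  let ?h = "qpoch_fps q a * inv_qpoch_fps q 1"
  have "lin (- a) * dilate q ?h = (lin (- a) * dilate q (qpoch_fps q a)) * dilate q (inv_qpoch_fps q 1)"
    by (simp only: dilate_mult mult.assoc)
  also have "\<dots> = lin (-1) * ?h"
    unfolding qpoch_fps_dilate[OF assms] inv_qpoch_fps_dilate[OF assms] by (simp only: mult_ac)
  finally have "fps_nth (lin (- a) * dilate q ?h) (Suc n) = fps_nth (lin (-1) * ?h) (Suc n)"
    by simp
  hence "(1 - q * q ^ n) * fps_nth ?h (Suc n) = (1 - a * q ^ n) * fps_nth ?h n"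
    unfolding lin_mult_nth dilate_nth by (simp add: algebra_simps)
  moreover have "1 - q * q ^ n \<noteq> 0"
    using one_minus_power_nonzero[OF assms, of "Suc n"] by simp
  moreover have "qpoch q q n \<noteq> 0"
    using assms by (intro qpoch_nonzero) auto
  ultimately show ?case
    unfolding Suc.IH qpoch_Suc by (simp add: divide_simps mult_ac)
qed simp

section \<open>Convergence and the value of Euler's series\<close>

lemma summable_power_choose_two:
  fixes s B :: real
  assumes "0 \<le> s" "s < 1" "0 \<le> B"
  shows "summable (\<lambda>n. B ^ n * s ^ (n choose 2))"
proof -
  \<comment> \<open>The ratio of consecutive terms is B s^n, which tends to 0 however large B
    is.\<close>
  have "(\<lambda>n. B * s ^ n) \<longlonglongrightarrow> B * 0"
    using assms by (intro tendsto_intros LIMSEQ_power_zero) auto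
  hence "eventually (\<lambda>n. B * s ^ n < 1 / 2) sequentially"
    by (rule order_tendstoD) simp
  then obtain N where N: "\<And>n. n \<ge> N \<Longrightarrow> B * s ^ n < 1 / 2"
    by (auto simp: eventually_sequentially)
  show ?thesis
  proof (rule summable_ratio_test[of "1 / 2" N])
    fix n assume "n \<ge> N"
    hence "B * s ^ n * (B ^ n * s ^ (n choose 2)) \<le> 1 / 2 * (B ^ n * s ^ (n choose 2))"
      using N[of n] assms by (intro mult_right_mono) auto
    thus "norm (B ^ Suc n * s ^ (Suc n choose 2)) \<le> 1 / 2 * norm (B ^ n * s ^ (n choose 2))"
      using assms by (simp add: choose_two_Suc power_add mult_ac abs_mult)
  qed simp
qed

lemma qpoch_fps_nth_norm_le:
  assumes "norm q < 1"
  shows "norm (fps_nth (qpoch_fps q a) n) \<le> (norm a / (1 - norm q)) ^ n * norm q ^ (n choose 2)"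
proof -
  have "norm (fps_nth (qpoch_fps q a) n) \<le> norm a ^ n * norm q ^ (n choose 2) / (1 - norm q) ^ n"
    unfolding qpoch_fps_nth norm_divide norm_mult norm_power norm_minus_cancel
    using assms qpoch_norm_ge[of q q n] by (intro divide_left_mono mult_pos_pos) (auto simp: qpoch_nonzero)
  thus ?thesis
    by (simp add: power_divide)
qed

text \<open>Unlike for \<open>qpoch_fps\<close>, no factor q^(n choose 2) helps here, so this bound
  alone does not give summability; in the fourfold series a quadratic power of q from elsewhere
  compensates.\<close>

lemma inv_qpoch_fps_nth_norm_le:
  assumes "norm q < 1"
  shows "norm (fps_nth (inv_qpoch_fps q a) n) \<le> (norm a / (1 - norm q)) ^ n"
proof -
  have "norm (fps_nth (inv_qpoch_fps q a) n) \<le> norm a ^ n / (1 - norm q) ^ n"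
    unfolding inv_qpoch_fps_nth norm_divide norm_mult norm_power
    using assms qpoch_norm_ge[of q q n] by (intro divide_left_mono mult_pos_pos) (auto simp: qpoch_nonzero)
  thus ?thesis
    by (simp add: power_divide)
qed

lemma summable_norm_qpoch_fps:
  assumes "norm q < 1"
  shows "summable (\<lambda>n. norm (fps_nth (qpoch_fps q a) n))"
proof (rule summable_comparison_test')
  show "summable (\<lambda>n. (norm a / (1 - norm q)) ^ n * norm q ^ (n choose 2))"
    using assms by (intro summable_power_choose_two) auto
  show "norm (norm (fps_nth (qpoch_fps q a) n)) \<le> (norm a / (1 - norm q)) ^ n * norm q ^ (n choose 2)" for n
    using qpoch_fps_nth_norm_le[OF assms, of a n] by simp
qed

lemma qpoch_fps_nth_scale: "fps_nth (qpoch_fps q (a * t)) n = fps_nth (qpoch_fps q a) n * t ^ n"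
  by (simp add: qpoch_fps_nth power_minus[of a] power_minus[of "a * t"] power_mult_distrib)

text \<open>The sum f(a) of the series satisfies f(a) = (1 - a) f(aq). Iterating gives f(a) =
  (a;q)_n f(a q^n), and f(a q^n) tends to f(0) = 1 by continuity.\<close>

lemma qpoch_fps_sums:
  assumes q: "norm q < 1"
  shows "fps_nth (qpoch_fps q a) sums qpoch_inf a q"
proof -
  define f where "f = (\<lambda>a. \<Sum>n. fps_nth (qpoch_fps q a) n)"
  have sums: "fps_nth (qpoch_fps q a) sums f a" for a
    unfolding f_def by (intro summable_sums summable_norm_cancel[OF summable_norm_qpoch_fps[OF q]])
  have step: "f a = (1 - a) * f (a * q)" for a
  proof -
    have e: "fps_nth (qpoch_fps q a) (Suc n)
        = fps_nth (qpoch_fps q (a * q)) (Suc n) - a * fps_nth (qpoch_fps q (a * q)) n" for n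
      using arg_cong[OF qpoch_fps_dilate[OF q, of a], of "\<lambda>f. fps_nth f (Suc n)"]
      unfolding lin_mult_nth dilate_nth qpoch_fps_nth_scale by (simp add: mult_ac)
    have "(\<lambda>n. fps_nth (qpoch_fps q (a * q)) (Suc n) - a * fps_nth (qpoch_fps q (a * q)) n)
        sums ((f (a * q) - 1) - a * f (a * q))"
      using sums[of "a * q"]
      by (intro sums_diff sums_mult) (auto simp: sums_Suc_iff)
    hence "(\<lambda>n. fps_nth (qpoch_fps q a) (Suc n)) sums ((f (a * q) - 1) - a * f (a * q))"
      by (simp only: e)
    hence "fps_nth (qpoch_fps q a) sums ((f (a * q) - 1) - a * f (a * q) + 1)"
      by (subst (asm) sums_Suc_iff) simp
    from sums_unique2[OF this sums] show ?thesis
      by (simp add: algebra_simps)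
  qed
  have iter: "f a = qpoch a q n * f (a * q ^ n)" for n
  proof (induction n)
    case (Suc n)
    with step[of "a * q ^ n"] show ?case
      by (simp add: qpoch_Suc mult_ac)
  qed simp
  \<comment> \<open>As a function of its argument, f is a power series converging everywhere, hence
    continuous at 0.\<close>
  have "isCont (\<lambda>t. \<Sum>n. fps_nth (qpoch_fps q 1) n * t ^ n) 0"
    by (rule isCont_powser_converges_everywhere, fold qpoch_fps_nth_scale)
       (rule summable_norm_cancel[OF summable_norm_qpoch_fps[OF q]])
  hence "isCont f 0"
    by (simp add: f_def flip: qpoch_fps_nth_scale)
  moreover have "(\<lambda>n. a * q ^ n) \<longlonglongrightarrow> a * 0"
    using q by (intro tendsto_intros LIMSEQ_power_zero)
  ultimately have "(\<lambda>n. f (a * q ^ n)) \<longlonglongrightarrow> f 0"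
    using isCont_tendsto_compose[of 0 f] by simp
  hence lim_f: "(\<lambda>n. f (a * q ^ Suc n)) \<longlonglongrightarrow> f 0"
    by (rule LIMSEQ_Suc)
  have "fps_nth (qpoch_fps q 0) = (\<lambda>n. if n = 0 then 1 else 0)"
    by (rule ext) (simp add: qpoch_fps_nth numeral_2_eq_2)
  hence f_0: "f 0 = 1"
    using sums_single[of 0 "\<lambda>_. 1 :: complex"] by (simp add: f_def sums_iff)
  have "(\<lambda>n. qpoch a q (Suc n)) \<longlonglongrightarrow> qpoch_inf a q"
    unfolding qpoch_def lessThan_Suc_atMost qpoch_inf_def
    by (intro convergent_prod_LIMSEQ convergent_prod_qpoch q)
  from tendsto_mult[OF this lim_f]
  have "(\<lambda>_ :: nat. f a) \<longlonglongrightarrow> qpoch_inf a q"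
    by (simp only: f_0 mult_1_right flip: iter)
  hence "f a = qpoch_inf a q"
    by (simp only: LIMSEQ_const_iff)
  with sums[of a] show ?thesis
    by simp
qed

lemma qpoch_fps_has_sum:
  assumes "norm q < 1"
  shows "(fps_nth (qpoch_fps q a) has_sum qpoch_inf a q) UNIV"
  by (rule norm_summable_imp_has_sum[OF summable_norm_qpoch_fps[OF assms] qpoch_fps_sums[OF assms]])

subsection \<open>Odd coefficients of \<open>(xt, -t/q; q)\<^sub>\<infinity>\<close>\<close>

text \<open>Coefficient comparison in (1 - at)(1 - bt) F(qt) = F(t) for F(t) = (at, bt;
  q)_inf.\<close>

lemma qpoch_fps_mult_rec:
  fixes q a b :: complex
  assumes q: "norm q < 1"
  defines "f \<equiv> fps_nth (qpoch_fps q a * qpoch_fps q b)"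
  shows "f 0 = 1"
    and "(1 - q) * f (Suc 0) = - (a + b)"
    and "(1 - q ^ Suc (Suc n)) * f (Suc (Suc n))
           = - (a + b) * q ^ Suc n * f (Suc n) + a * b * q ^ n * f n"
proof -
  let ?F = "qpoch_fps q a * qpoch_fps q b"
  have "lin (- a) * (lin (- b) * dilate q ?F)
      = (lin (- a) * dilate q (qpoch_fps q a)) * (lin (- b) * dilate q (qpoch_fps q b))"
    by (simp only: dilate_mult mult_ac)
  hence eq: "fps_nth (lin (- a) * (lin (- b) * dilate q ?F)) m = f m" for m
    by (simp only: qpoch_fps_dilate[OF q] f_def)
  show "f 0 = 1"
    by (simp add: f_def)
  with eq[of "Suc 0"] show "(1 - q) * f (Suc 0) = - (a + b)"
    unfolding lin_mult_nth dilate_nth by (fold f_def) (simp add: algebra_simps)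
  show "(1 - q ^ Suc (Suc n)) * f (Suc (Suc n))
          = - (a + b) * q ^ Suc n * f (Suc n) + a * b * q ^ n * f n"
    using eq[of "Suc (Suc n)"]
    unfolding lin_mult_nth dilate_nth by (fold f_def) (simp add: algebra_simps)
qed

text \<open>Three consecutive instances of the recurrence eliminate \<open>f (n + 3)\<close> and
  \<open>f (n + 1)\<close>. The result links only indices of one parity, so the odd coefficients can
  be treated by themselves.\<close>

lemma qpoch_fps_mult_rec2:
  fixes q a b :: complex
  assumes q: "norm q < 1"
  defines "f \<equiv> fps_nth (qpoch_fps q a * qpoch_fps q b)"
  shows "(1 - q ^ 4 * q ^ n) * (1 - q ^ 3 * q ^ n) * f (n + 4)
    = ((a + b)\<^sup>2 * (q ^ 5 * (q ^ n)\<^sup>2) + a * b * (q ^ 3 * q ^ n) * (1 - q ^ 2 * q ^ n)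
        + a * b * (q ^ 2 * q ^ n) * (1 - q ^ 3 * q ^ n)) * f (n + 2)
      - (a * b)\<^sup>2 * (q ^ 3 * (q ^ n)\<^sup>2) * f n"
proof -
  note rec = qpoch_fps_mult_rec(3)[OF q, where a = a and b = b, folded f_def]
  define t where "t = q ^ n"
  have r4: "(1 - q ^ 4 * t) * f (n + 4) = - (a + b) * q ^ 3 * t * f (n + 3) + a * b * q ^ 2 * t * f (n + 2)"
    using rec[of "n + 2"] by (simp add: t_def numeral_eq_Suc mult_ac)
  have r3: "(1 - q ^ 3 * t) * f (n + 3) = - (a + b) * q ^ 2 * t * f (n + 2) + a * b * q * t * f (n + 1)"
    using rec[of "n + 1"] by (simp add: t_def numeral_eq_Suc mult_ac)
  have r2: "(1 - q ^ 2 * t) * f (n + 2) = - (a + b) * q * t * f (n + 1) + a * b * t * f n"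
    using rec[of n] by (simp add: t_def numeral_eq_Suc mult_ac)
  show ?thesis
    unfolding t_def[symmetric] using r4 r3 r2 by algebra
qed

text \<open>With t for the variable this is (-qt, -q^3 x^2 t; q^2)_inf / (-xt; q)_inf.\<close>

definition triple_fps :: "complex \<Rightarrow> complex \<Rightarrow> complex fps" where
  "triple_fps q x = inv_qpoch_fps q (- x) * qpoch_fps (q\<^sup>2) (- q) * qpoch_fps (q\<^sup>2) (- (q ^ 3 * x\<^sup>2))"

lemma dilate_lin: "dilate c (lin a) = lin (c * a)"
proof (rule fps_ext)
  fix n show "fps_nth (dilate c (lin a)) n = fps_nth (lin (c * a)) n"
    using lin_mult_nth[of a 1] lin_mult_nth[of "c * a" 1] by (cases n) auto
qed

lemma norm_power2_less_1: "norm q < 1 \<Longrightarrow> norm (q\<^sup>2) < 1" for q :: complex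
  by (simp add: norm_power power_less_one_iff)

text \<open>Replacing t by q^2 t is one step for the two products in base q^2 but two steps for the
  reciprocal in base q. Hence (1 + qt)(1 + q^3 x^2 t) D(q^2 t) = (1 + xt)(1 + qxt) D(t), and
  coefficients are compared.\<close>

lemma triple_fps_rec:
  fixes q x :: complex
  assumes q: "norm q < 1"
  defines "d \<equiv> fps_nth (triple_fps q x)"
  shows "d 0 = 1"
    and "(1 - q\<^sup>2) * d (Suc 0) = q + q ^ 3 * x\<^sup>2 - x - q * x"
    and "(1 - q ^ 4 * (q ^ n)\<^sup>2) * d (n + 2)
           = (q ^ 3 * (1 + q\<^sup>2 * x\<^sup>2) * (q ^ n)\<^sup>2 - x * (1 + q)) * d (n + 1)
             - q * x\<^sup>2 * (1 - q ^ 3 * (q ^ n)\<^sup>2) * d n"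
proof -
  let ?D = "triple_fps q x" and ?v = "q ^ 3 * x\<^sup>2"
  note q2 = norm_power2_less_1[OF q]
  have "dilate (q\<^sup>2) (inv_qpoch_fps q (- x)) = dilate q (dilate q (inv_qpoch_fps q (- x)))"
    by (simp add: dilate_dilate power2_eq_square)
  also have "\<dots> = lin (q * x) * (lin x * inv_qpoch_fps q (- x))"
    by (simp only: inv_qpoch_fps_dilate[OF q] dilate_mult dilate_lin minus_minus)
  finally have R: "dilate (q\<^sup>2) (inv_qpoch_fps q (- x))
      = lin (q * x) * (lin x * inv_qpoch_fps q (- x))" .
  have "lin q * (lin ?v * dilate (q\<^sup>2) ?D)
      = dilate (q\<^sup>2) (inv_qpoch_fps q (- x)) * (lin (- (- q)) * dilate (q\<^sup>2) (qpoch_fps (q\<^sup>2) (- q)))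
        * (lin (- (- ?v)) * dilate (q\<^sup>2) (qpoch_fps (q\<^sup>2) (- ?v)))"
    by (simp only: triple_fps_def dilate_mult minus_minus mult_ac)
  also have "\<dots> = lin (q * x) * (lin x * ?D)"
    unfolding R qpoch_fps_dilate[OF q2] triple_fps_def by (simp only: mult_ac)
  finally have eq: "fps_nth (lin q * (lin ?v * dilate (q\<^sup>2) ?D)) m
      = fps_nth (lin (q * x) * (lin x * ?D)) m" for m
    by simp
  show "d 0 = 1"
    by (simp add: d_def triple_fps_def)
  with eq[of "Suc 0"] show "(1 - q\<^sup>2) * d (Suc 0) = q + q ^ 3 * x\<^sup>2 - x - q * x"
    unfolding lin_mult_nth dilate_nth by (fold d_def) (simp add: algebra_simps)
  define t where "t = q ^ n"
  have pows: "(q\<^sup>2) ^ n = t\<^sup>2"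
    by (simp add: t_def flip: power_mult) (simp add: mult.commute)
  have "q ^ 4 * t\<^sup>2 * d (n + 2) + ?v * (q\<^sup>2 * t\<^sup>2 * d (n + 1))
        + q * (q\<^sup>2 * t\<^sup>2 * d (n + 1) + ?v * (t\<^sup>2 * d n))
      = d (n + 2) + x * d (n + 1) + q * x * (d (n + 1) + x * d n)"
    using eq[of "Suc (Suc n)"]
    unfolding lin_mult_nth dilate_nth power_Suc pows
    by (fold d_def) (simp add: numeral_eq_Suc mult_ac)
  thus "(1 - q ^ 4 * (q ^ n)\<^sup>2) * d (n + 2)
      = (q ^ 3 * (1 + q\<^sup>2 * x\<^sup>2) * (q ^ n)\<^sup>2 - x * (1 + q)) * d (n + 1)
        - q * x\<^sup>2 * (1 - q ^ 3 * (q ^ n)\<^sup>2) * d n"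
    unfolding t_def[symmetric] by algebra
qed

text \<open>Two-step induction: for a = x and b = -1/q the parity-preserving recurrence of f,
  multiplied by the finite products in base q^2, becomes the recurrence of d.\<close>

lemma odd_coeff:
  fixes q x :: complex
  assumes q: "norm q < 1" "q \<noteq> 0"
  defines "f \<equiv> fps_nth (qpoch_fps q x * qpoch_fps q (- 1 / q))"
  defines "d \<equiv> fps_nth (triple_fps q x)"
  shows "f (2 * n + 1) * qpoch q (q\<^sup>2) (Suc n) = (1 / q - x) * (q\<^sup>2) ^ (n choose 2) * d n"
proof -
  define s where "s = 1 / q - x"
  \<comment> \<open>Naming the inverse turns division by q into the polynomial relation u q = 1,
    which \<open>algebra\<close> can use.\<close>
  define u where "u = 1 / q"
  have uq: "u * q = 1" and su: "s = u - x"
    using q(2) by (simp_all add: s_def u_def)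
  have s: "- (x + - 1 / q) = s"
    by (simp add: s_def)
  note rec = qpoch_fps_mult_rec[OF q(1), where a = x and b = "- 1 / q", folded f_def]
  note drec = triple_fps_rec[OF q(1), where x = x, folded d_def]
  have nz: "1 - q ^ m \<noteq> 0" if "m > 0" for m
    using one_minus_power_nonzero q(1) that by blast
  have f1: "(1 - q) * f 1 = s"
    using rec(2) by (simp add: s_def)
  have "f (2 * n + 1) * qpoch q (q\<^sup>2) (Suc n) = s * (q\<^sup>2) ^ (n choose 2) * d n"
  proof (induction n rule: induct_nat_012)
    case 0
    show ?case
      using f1 drec(1) by (simp add: qpoch_Suc numeral_2_eq_2 mult.commute)
  next
    case 1
    have r2: "(1 - q\<^sup>2) * f 2 = s * q * f 1 - x * u"
      using rec(3)[of 0] unfolding s by (simp add: numeral_2_eq_2 u_def rec(1))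
    have r3: "(1 - q ^ 3) * f 3 = s * q\<^sup>2 * f 2 - x * f 1"
      using rec(3)[of 1] q(2) unfolding s by (simp add: numeral_eq_Suc)
    have d1: "(1 - q\<^sup>2) * d 1 = q + q ^ 3 * x\<^sup>2 - x - q * x"
      using drec(2) by simp
    \<comment> \<open>The values \<open>f 2\<close> and \<open>d 1\<close> are known only after
      multiplication by 1 - q^2, so this factor is carried along and cancelled afterwards.\<close>
    have "(1 - q\<^sup>2) * (f 3 * ((1 - q) * (1 - q ^ 3))) = (1 - q\<^sup>2) * (s * d 1)"
      using r2 r3 d1 f1 uq su by algebra
    hence "f 3 * ((1 - q) * (1 - q ^ 3)) = s * d 1"
      using nz[of 2] by simp
    thus ?case
      by (simp add: qpoch_Suc numeral_eq_Suc mult_ac)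
  next
    case (ge2 n)
    define t where "t = q ^ n"
    define P where "P = qpoch q (q\<^sup>2) (Suc n)"
    define e where "e = (q\<^sup>2) ^ (n choose 2)"
    have Q: "(q\<^sup>2) ^ n = t\<^sup>2"
      by (simp add: t_def flip: power_mult) (simp add: mult.commute)
    have IH1: "f (2 * n + 1) * P = s * e * d n"
      using ge2.IH(1) by (simp add: P_def e_def)
    have P1: "qpoch q (q\<^sup>2) (Suc (Suc n)) = P * (1 - q ^ 3 * t\<^sup>2)"
      unfolding qpoch_Suc[of _ _ "Suc n"] P_def power_Suc Q by (simp add: numeral_eq_Suc mult_ac)
    have P2: "qpoch q (q\<^sup>2) (Suc (Suc (Suc n))) = P * (1 - q ^ 3 * t\<^sup>2) * (1 - q ^ 5 * t\<^sup>2)"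
      unfolding qpoch_Suc[of _ _ "Suc (Suc n)"] P1 power_Suc Q by (simp add: numeral_eq_Suc mult_ac)
    have e1: "(q\<^sup>2) ^ (Suc n choose 2) = e * t\<^sup>2"
      by (simp add: choose_two_Suc power_add Q e_def)
    have e2: "(q\<^sup>2) ^ (Suc (Suc n) choose 2) = e * q\<^sup>2 * t ^ 4"
      unfolding choose_two_Suc[of "Suc n"] power_add e1 power_Suc Q by (simp add: numeral_eq_Suc mult_ac)
    have IH2: "f (2 * n + 3) * (P * (1 - q ^ 3 * t\<^sup>2)) = s * (e * t\<^sup>2) * d (n + 1)"
      using ge2.IH(2) unfolding P1 e1 by (simp add: numeral_eq_Suc)
    have frec: "(1 - q ^ 5 * t\<^sup>2) * (1 - q ^ 4 * t\<^sup>2) * f (2 * n + 5)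
        = (s\<^sup>2 * q ^ 7 * t ^ 4 - x * q ^ 3 * t\<^sup>2 * (1 - q ^ 3 * t\<^sup>2)
            - x * q ^ 2 * t\<^sup>2 * (1 - q ^ 4 * t\<^sup>2)) * f (2 * n + 3)
          - x\<^sup>2 * q ^ 3 * t ^ 4 * f (2 * n + 1)"
    proof -
      have eq: "q ^ (2 * n + 1) = q * t\<^sup>2"
        by (simp add: t_def flip: power_mult) (simp add: mult.commute)
      have f_eq: "f = fps_nth (qpoch_fps q x * qpoch_fps q (- u))"
        by (simp add: f_def u_def)
      have "(1 - q ^ 4 * (q * t\<^sup>2)) * (1 - q ^ 3 * (q * t\<^sup>2)) * f (2 * n + 5)
          = ((x + - u)\<^sup>2 * (q ^ 5 * (q * t\<^sup>2)\<^sup>2) + x * - u * (q ^ 3 * (q * t\<^sup>2)) * (1 - q ^ 2 * (q * t\<^sup>2))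
              + x * - u * (q ^ 2 * (q * t\<^sup>2)) * (1 - q ^ 3 * (q * t\<^sup>2))) * f (2 * n + 3)
            - (x * - u)\<^sup>2 * (q ^ 3 * (q * t\<^sup>2)\<^sup>2) * f (2 * n + 1)"
        using qpoch_fps_mult_rec2[OF q(1), where a = x and b = "- u" and n = "2 * n + 1"]
        unfolding f_eq eq by (simp only: add.assoc numeral_plus_numeral add_num_simps one_plus_numeral)
      thus ?thesis
        using uq su by algebra
    qed
    \<comment> \<open>Multiplying \<open>frec\<close> by P (1 - q^3 t^2) produces exactly the
      products evaluated by the induction hypotheses; the factor 1 - q^4 t^2 is also the leading
      factor in the recurrence of d.\<close>
    have "(1 - q ^ 4 * t\<^sup>2) * (f (2 * n + 5) * (P * (1 - q ^ 3 * t\<^sup>2) * (1 - q ^ 5 * t\<^sup>2)))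
        = (s\<^sup>2 * q ^ 7 * t ^ 4 - x * q ^ 3 * t\<^sup>2 * (1 - q ^ 3 * t\<^sup>2)
            - x * q ^ 2 * t\<^sup>2 * (1 - q ^ 4 * t\<^sup>2)) * (f (2 * n + 3) * (P * (1 - q ^ 3 * t\<^sup>2)))
          - x\<^sup>2 * q ^ 3 * t ^ 4 * (1 - q ^ 3 * t\<^sup>2) * (f (2 * n + 1) * P)"
      using frec by algebra
    also have "\<dots> = (1 - q ^ 4 * t\<^sup>2) * (s * (e * q\<^sup>2 * t ^ 4) * d (n + 2))"
    proof -
      \<comment> \<open>Since s q = 1 - qx, the square of s disappears; one s remains as a common
        factor, and the coefficients of \<open>d (n + 1)\<close> agree as polynomials in q, x and
        t.\<close>
      have sq: "s\<^sup>2 * q ^ 7 = (1 - q * x)\<^sup>2 * q ^ 5"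
        using su uq by algebra
      show ?thesis
        unfolding IH1 IH2 sq using drec(3)[of n, folded t_def] by algebra
    qed
    finally have "(1 - q ^ 4 * t\<^sup>2) * (f (2 * n + 5) * (P * (1 - q ^ 3 * t\<^sup>2) * (1 - q ^ 5 * t\<^sup>2)))
        = (1 - q ^ 4 * t\<^sup>2) * (s * (e * q\<^sup>2 * t ^ 4) * d (n + 2))" .
    moreover have "1 - q ^ 4 * t\<^sup>2 \<noteq> 0"
      using nz[of "4 + n * 2"] by (simp add: t_def power_add power_mult)
    ultimately have "f (2 * n + 5) * (P * (1 - q ^ 3 * t\<^sup>2) * (1 - q ^ 5 * t\<^sup>2))
        = s * (e * q\<^sup>2 * t ^ 4) * d (n + 2)"
      by simp
    thus ?case
      unfolding P2 e2 by (simp add: numeral_eq_Suc)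
  qed
  thus ?thesis
    by (simp add: s_def)
qed

subsection \<open>Summation\<close>

text \<open>Cauchy product of two absolutely convergent Euler series; scaling both parameters by y
  contributes y^n in degree n.\<close>

lemma qpoch_fps_mult_sums:
  assumes q: "norm q < 1"
  shows "(\<lambda>n. fps_nth (qpoch_fps q a * qpoch_fps q b) n * y ^ n)
           sums (qpoch_inf (a * y) q * qpoch_inf (b * y) q)"
proof -
  have "(\<Sum>i\<le>n. fps_nth (qpoch_fps q (a * y)) i * fps_nth (qpoch_fps q (b * y)) (n - i))
      = fps_nth (qpoch_fps q a * qpoch_fps q b) n * y ^ n" for n
    unfolding fps_mult_nth sum_distrib_right atLeast0AtMost qpoch_fps_nth_scale
    by (intro sum.cong) (auto simp: mult_ac simp flip: power_add)
  moreover have "(\<Sum>n. fps_nth (qpoch_fps q a) n) = qpoch_inf a q" for a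
    using qpoch_fps_sums[OF q] by (simp add: sums_iff)
  ultimately show ?thesis
    using Cauchy_product_sums[OF summable_norm_qpoch_fps[OF q] summable_norm_qpoch_fps[OF q], of "a * y" "b * y"]
    by simp
qed

text \<open>In half the difference of the two series the even terms cancel, so restricting to odd
  indices leaves the sum unchanged.\<close>

lemma sums_odd_part:
  fixes c :: "nat \<Rightarrow> 'a :: real_normed_field"
  assumes "(\<lambda>n. c n * y ^ n) sums s" "(\<lambda>n. c n * (- y) ^ n) sums t"
  shows "(\<lambda>n. c (2 * n + 1) * y ^ (2 * n + 1)) sums ((s - t) / 2)"
proof -
  let ?g = "\<lambda>n. (c n * y ^ n - c n * (- y) ^ n) / 2"
  have "?g sums ((s - t) / 2)"
    by (intro sums_divide sums_diff assms)
  moreover have "strict_mono (\<lambda>n :: nat. 2 * n + 1)"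
    by (auto intro: strict_monoI)
  moreover have "?g n = 0" if "n \<notin> range (\<lambda>n. 2 * n + 1)" for n
  proof -
    have "even n"
      using that by (metis oddE rangeI)
    thus ?thesis by simp
  qed
  ultimately have "(\<lambda>n. ?g (2 * n + 1)) sums ((s - t) / 2)"
    by (subst sums_mono_reindex) auto
  thus ?thesis
    by (simp add: mult_ac)
qed

section \<open>Grouping and absolute summability of multiple series\<close>

lemma fps_nth_mult3:
  fixes f g h :: "'a :: comm_semiring_1 fps"
  shows "fps_nth (f * g * h) n
    = (\<Sum>(i, j, k) | i + j + k = n. fps_nth f i * fps_nth g j * fps_nth h k)"
proof -
  have "fps_nth (f * g * h) n
      = (\<Sum>(m, i) \<in> Sigma {0..n} (\<lambda>m. {0..m}). fps_nth f i * fps_nth g (m - i) * fps_nth h (n - m))"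
    by (simp add: fps_mult_nth sum_distrib_right sum.Sigma)
  also have "\<dots> = (\<Sum>(i, j, k) | i + j + k = n. fps_nth f i * fps_nth g j * fps_nth h k)"
    by (rule sum.reindex_bij_witness[where j = "\<lambda>(m, i). (i, m - i, n - m)" and i = "\<lambda>(i, j, k). (i + j, i)"])
       auto
  finally show ?thesis .
qed

lemma has_sum_group_total_degree:
  fixes F :: "nat \<times> nat \<times> nat \<Rightarrow> 'a :: {topological_comm_monoid_add, t3_space}"
  assumes "(F has_sum S) UNIV"
  shows "((\<lambda>n. \<Sum>(i, j, k) | i + j + k = n. F (i, j, k)) has_sum S) UNIV"
proof -
  let ?T = "\<lambda>n. {(i, j, k). i + j + k = (n :: nat)}"
  have "finite (?T n)" for n
    by (rule finite_subset[of _ "{..n} \<times> {..n} \<times> {..n}"]) auto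
  moreover have "((\<lambda>(n, p). F p) has_sum S) (Sigma UNIV ?T)"
    using assms
    by (subst has_sum_reindex_bij_witness[where j = snd and i = "\<lambda>(i, j, k). (i + j + k, i, j, k)"
          and h = F and T = UNIV]) auto
  ultimately show ?thesis
    by (elim has_sum_SigmaD) (auto intro!: has_sum_finiteI sum.cong)
qed

lemma norm_summable_on_product:
  fixes f :: "'a \<Rightarrow> 'c :: {real_normed_field, banach}"
  assumes "(\<lambda>x. norm (f x)) summable_on A" "(\<lambda>y. norm (g y)) summable_on B"
  shows "(\<lambda>p. norm (case p of (x, y) \<Rightarrow> f x * g y)) summable_on A \<times> B"
  unfolding Infinite_Sum.abs_summable_on_Sigma_iff
  using assms by (auto simp: norm_mult abs_mult infsum_cmult_right' intro!: summable_on_cmult_right summable_on_cmult_left)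

lemma abs_summable_power_choose_two:
  fixes s b :: real
  assumes "0 \<le> s" "s < 1" "0 \<le> b"
  shows "(\<lambda>n. norm (b ^ n * s ^ (n choose 2))) summable_on UNIV"
  using summable_power_choose_two[OF assms] assms
  by (intro norm_summable_imp_summable_on) (simp add: abs_mult)

lemma choose_two_mono: "m \<le> n \<Longrightarrow> m choose 2 \<le> n choose 2"
  by (induction rule: dec_induct) (simp_all add: choose_two_Suc)

section \<open>The fourfold series and its two orders of summation\<close>

context
  fixes q x y :: complex
  assumes q: "norm q < 1"
begin

definition triple_term :: "nat \<Rightarrow> nat \<Rightarrow> nat \<Rightarrow> complex" where
  "triple_term j l m = fps_nth (inv_qpoch_fps q (- x)) j * fps_nth (qpoch_fps (q\<^sup>2) (- q)) l
     * fps_nth (qpoch_fps (q\<^sup>2) (- (q ^ 3 * x\<^sup>2))) m"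

text \<open>The index r runs through Euler's expansion of (q^(2M+3); q^2)_inf with M = j + l + m.
  Summing over r first leads to the product side; summing over m + r = k first gives the summand of
  the theorem.\<close>

definition quadruple_term :: "(nat \<times> nat \<times> nat) \<times> nat \<Rightarrow> complex" where
  "quadruple_term = (\<lambda>((j, l, m), r). triple_term j l m * y ^ (2 * (j + l + m)) * (q\<^sup>2) ^ ((j + l + m) choose 2)
     * fps_nth (qpoch_fps (q\<^sup>2) (q ^ (2 * (j + l + m) + 3))) r)"

text \<open>The majorant is a product of four convergent series in one index each, with |y|^(2M)
  distributed over j, l and m.\<close>

lemma quadruple_term_abs_summable: "(\<lambda>p. norm (quadruple_term p)) summable_on UNIV"
proof -
  define s where "s = norm (q\<^sup>2)"
  note q2 = norm_power2_less_1[OF q]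
  have s: "0 \<le> s" "s < 1"
    using q2 by (auto simp: s_def)
  define Y where "Y = (norm y)\<^sup>2"
  define c1 where "c1 = norm x / (1 - norm q)"
  define c2 where "c2 = norm q / (1 - s)"
  define c3 where "c3 = norm (q ^ 3 * x\<^sup>2) / (1 - s)"
  define b where "b = 1 / (1 - s)"
  define g where "g = (\<lambda>b n. b ^ n * s ^ (n choose 2) :: real)"
  have nn: "0 \<le> Y" "0 \<le> c1" "0 \<le> c2" "0 \<le> c3" "0 \<le> b"
    using q s by (auto simp: Y_def c1_def c2_def c3_def b_def)
  have "(\<lambda>p. norm (case p of ((j, l, m), r) \<Rightarrow> g (c1 * Y) j * (g (c2 * Y) l * g (c3 * Y) m) * g b r)) summable_on UNIV"
    using norm_summable_on_product[OF norm_summable_on_product[OF _ norm_summable_on_product],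
        of "g (c1 * Y)" UNIV "g (c2 * Y)" UNIV "g (c3 * Y)" UNIV "g b" UNIV]
      abs_summable_power_choose_two[OF s] nn
    by (simp add: g_def case_prod_unfold)
  thus ?thesis
  proof (rule Infinite_Sum.abs_summable_on_comparison_test)
    fix p :: "(nat \<times> nat \<times> nat) \<times> nat"
    obtain j l m r where p: "p = ((j, l, m), r)"
      by (metis prod.exhaust)
    have 1: "norm (fps_nth (inv_qpoch_fps q (- x)) j) \<le> c1 ^ j"
      using inv_qpoch_fps_nth_norm_le[OF q, of "- x" j] by (simp add: c1_def)
    have 2: "norm (fps_nth (qpoch_fps (q\<^sup>2) (- q)) l) \<le> c2 ^ l * s ^ (l choose 2)"
      using qpoch_fps_nth_norm_le[OF q2, of "- q" l] by (simp add: s_def c2_def)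
    have 3: "norm (fps_nth (qpoch_fps (q\<^sup>2) (- (q ^ 3 * x\<^sup>2))) m)
        \<le> c3 ^ m * s ^ (m choose 2)"
      using qpoch_fps_nth_norm_le[OF q2, of "- (q ^ 3 * x\<^sup>2)" m] by (simp add: s_def c3_def)
    have "norm (fps_nth (qpoch_fps (q\<^sup>2) (q ^ (2 * (j + l + m) + 3))) r)
        \<le> (norm (q ^ (2 * (j + l + m) + 3)) / (1 - s)) ^ r * s ^ (r choose 2)"
      using qpoch_fps_nth_norm_le[OF q2, of "q ^ (2 * (j + l + m) + 3)" r] by (simp add: s_def)
    \<comment> \<open>As |q^(2M+3)| <= 1, the bound in r is uniform in j, l and m.\<close>
    also have "\<dots> \<le> b ^ r * s ^ (r choose 2)"
      using q s unfolding b_def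
      by (intro mult_right_mono power_mono divide_right_mono) (auto simp: norm_power intro!: power_le_one)
    finally have 4: "norm (fps_nth (qpoch_fps (q\<^sup>2) (q ^ (2 * (j + l + m) + 3))) r) \<le> g b r"
      by (simp add: g_def)
    \<comment> \<open>The quadratic decay of (q^2)^(M choose 2) is given to j, whose own coefficient
      has only a geometric bound.\<close>
    have 5: "norm ((q\<^sup>2) ^ ((j + l + m) choose 2)) \<le> s ^ (j choose 2)"
      unfolding norm_power[of "q\<^sup>2"] s_def[symmetric]
      using s by (intro power_decreasing choose_two_mono) auto
    have 6: "norm (y ^ (2 * (j + l + m))) = Y ^ j * Y ^ l * Y ^ m"
      by (simp add: Y_def norm_power flip: power_mult power_add)
    have "norm (quadruple_term p) \<le>
        (c1 ^ j * (c2 ^ l * s ^ (l choose 2))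
          * (c3 ^ m * s ^ (m choose 2)))
        * (Y ^ j * Y ^ l * Y ^ m) * s ^ (j choose 2) * g b r"
      unfolding p quadruple_term_def triple_term_def prod.case norm_mult 6
      using q s nn
      by (intro mult_mono 1 2 3 4 5 order_refl mult_nonneg_nonneg zero_le_power norm_ge_zero) (simp_all add: g_def)
    also have "\<dots> = g (c1 * Y) j * (g (c2 * Y) l * g (c3 * Y) m) * g b r"
      by (simp only: g_def power_mult_distrib mult_ac)
    also have "\<dots> \<le> norm \<dots>"
      by simp
    finally show "norm (quadruple_term p) \<le> norm (case p of ((j, l, m), r) \<Rightarrow> g (c1 * Y) j * (g (c2 * Y) l * g (c3 * Y) m) * g b r)"
      by (simp add: p)
  qed
qed

lemma quadruple_term_has_sum_inner:
  "((\<lambda>r. quadruple_term ((j, l, m), r)) has_sum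
     (triple_term j l m * y ^ (2 * (j + l + m)) * (q\<^sup>2) ^ ((j + l + m) choose 2)
       * qpoch_inf (q ^ (2 * (j + l + m) + 3)) (q\<^sup>2))) UNIV"
  unfolding quadruple_term_def prod.case
  by (intro has_sum_cmult_right qpoch_fps_has_sum norm_power2_less_1 q)

lemma sum_triple_term: "(\<Sum>(j, l, m) | j + l + m = n. triple_term j l m) = fps_nth (triple_fps q x) n"
  unfolding triple_fps_def fps_nth_mult3 triple_term_def ..

text \<open>After summation over r and grouping by M, \<open>odd_coeff\<close> turns the series into
  the odd part in y of the expansion of (xy, -y/q; q)_inf.\<close>

lemma quadruple_term_has_sum:
  assumes q0: "q \<noteq> 0" and ne: "y / q - x * y \<noteq> 0"
  shows "(quadruple_term has_sum
     (qpoch_inf q (q\<^sup>2) / (2 * (y / q - x * y))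
       * (qpoch_inf (x * y) q * qpoch_inf (- y / q) q
          - qpoch_inf (- (x * y)) q * qpoch_inf (y / q) q))) UNIV"
proof -
  let ?K = "qpoch_inf q (q\<^sup>2)"
  let ?f = "fps_nth (qpoch_fps q x * qpoch_fps q (- 1 / q))"
  obtain S where S: "(quadruple_term has_sum S) UNIV"
    using abs_summable_summable[OF quadruple_term_abs_summable] by (auto simp: summable_on_def)
  have "((\<lambda>(j, l, m). triple_term j l m * y ^ (2 * (j + l + m)) * (q\<^sup>2) ^ ((j + l + m) choose 2)
           * qpoch_inf (q ^ (2 * (j + l + m) + 3)) (q\<^sup>2)) has_sum S) UNIV"
    by (rule has_sum_SigmaD[where f = quadruple_term and B = "\<lambda>_. UNIV"]) (use S quadruple_term_has_sum_inner in auto)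
  from has_sum_group_total_degree[OF this]
  have "((\<lambda>n. \<Sum>(j, l, m) | j + l + m = n. triple_term j l m * y ^ (2 * n) * (q\<^sup>2) ^ (n choose 2)
           * qpoch_inf (q ^ (2 * n + 3)) (q\<^sup>2)) has_sum S) UNIV"
    by (rule has_sum_cong[THEN iffD1, rotated]) (auto intro!: sum.cong)
  also have "(\<lambda>n. \<Sum>(j, l, m) | j + l + m = n. triple_term j l m * y ^ (2 * n) * (q\<^sup>2) ^ (n choose 2)
           * qpoch_inf (q ^ (2 * n + 3)) (q\<^sup>2))
      = (\<lambda>n. ?K / (y / q - x * y) * (?f (2 * n + 1) * y ^ (2 * n + 1)))"
  proof (rule ext)
    fix n
    have "?K = qpoch q (q\<^sup>2) (Suc n) * qpoch_inf (q * (q\<^sup>2) ^ Suc n) (q\<^sup>2)"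
      by (rule qpoch_inf_split[OF norm_power2_less_1[OF q]])
    also have "q * (q\<^sup>2) ^ Suc n = q ^ (2 * n + 3)"
      by (simp add: power_add power_mult power2_eq_square power3_eq_cube)
    finally have K: "?K = qpoch q (q\<^sup>2) (Suc n) * qpoch_inf (q ^ (2 * n + 3)) (q\<^sup>2)" .
    let ?G = "qpoch_inf (q ^ (2 * n + 3)) (q\<^sup>2)"
    let ?P = "qpoch q (q\<^sup>2) (Suc n)" and ?e = "(q\<^sup>2) ^ (n choose 2)"
    have "(\<Sum>(j, l, m) | j + l + m = n. triple_term j l m * y ^ (2 * n) * ?e * ?G)
        = fps_nth (triple_fps q x) n * (y ^ (2 * n) * ?e * ?G)"
      by (simp add: sum_distrib_right case_prod_unfold mult.assoc flip: sum_triple_term)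
    \<comment> \<open>Here y/q - xy = y (1/q - x): the second factor is the one in
      \<open>odd_coeff\<close>, and the extra y makes the exponent odd.\<close>
    also have "(y / q - x * y) * \<dots> = ?f (2 * n + 1) * ?P * ?G * y ^ (2 * n + 1)"
      unfolding odd_coeff[OF q q0] by (simp add: field_simps)
    also have "\<dots> = ?K * (?f (2 * n + 1) * y ^ (2 * n + 1))"
      unfolding K by (simp only: mult_ac)
    finally show "(\<Sum>(j, l, m) | j + l + m = n. triple_term j l m * y ^ (2 * n) * ?e * ?G)
        = ?K / (y / q - x * y) * (?f (2 * n + 1) * y ^ (2 * n + 1))"
      using ne by (simp add: field_simps)
  qed
  finally have "(\<lambda>n. ?K / (y / q - x * y) * (?f (2 * n + 1) * y ^ (2 * n + 1))) sums S"
    by (rule has_sum_imp_sums)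
  moreover have "(\<lambda>n. ?K / (y / q - x * y) * (?f (2 * n + 1) * y ^ (2 * n + 1))) sums
      (?K / (y / q - x * y) * ((qpoch_inf (x * y) q * qpoch_inf (- 1 / q * y) q
          - qpoch_inf (x * - y) q * qpoch_inf (- 1 / q * - y) q) / 2))"
    by (intro sums_mult sums_odd_part qpoch_fps_mult_sums q)
  ultimately have "S = ?K / (y / q - x * y) * ((qpoch_inf (x * y) q * qpoch_inf (- 1 / q * y) q
          - qpoch_inf (x * - y) q * qpoch_inf (- 1 / q * - y) q) / 2)"
    by (rule sums_unique2)
  with S show ?thesis
    by (simp add: mult.commute)
qed

text \<open>Apart from a prefactor depending on m and r only through k = m + r, the term is a
  product of a coefficient in m and one in r, so that summation over m + r = k is a Cauchy
  product.\<close>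

lemma quadruple_term_eq:
  "quadruple_term ((j, l, m), r) = x ^ j * y ^ (2 * j + 2 * l) / (qpoch q q j * qpoch (q\<^sup>2) (q\<^sup>2) l)
     * (- 1) ^ (j + (m + r)) * q ^ ((j + (m + r) + l) * (j + (m + r) + l - 1) + l\<^sup>2 + 3 * (m + r))
     * (fps_nth (qpoch_fps (q\<^sup>2) (x\<^sup>2 * y\<^sup>2)) m * fps_nth (inv_qpoch_fps (q\<^sup>2) 1) r)"
proof -
  define M N where "M = j + l + m" and "N = j + (m + r) + l"
  define c where "c = (\<lambda>n :: nat. n * (n - 1))"
  define E F where "E = c N + l\<^sup>2 + 3 * (m + r)" and "F = (2 * M + 3) * r"
  let ?den = "qpoch q q j * qpoch (q\<^sup>2) (q\<^sup>2) l * qpoch (q\<^sup>2) (q\<^sup>2) m * qpoch (q\<^sup>2) (q\<^sup>2) r"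
  \<comment> \<open>This form avoids truncated subtraction, so the exponent identity below is
    polynomial.\<close>
  have sq: "c n + n = n\<^sup>2" for n
    by (cases n) (auto simp: c_def power2_eq_square)
  have pc: "(q\<^sup>2) ^ (n choose 2) = q ^ c n" for n
    by (simp add: c_def two_choose_two flip: power_mult)
  have "N = M + r"
    by (simp add: M_def N_def)
  hence "N\<^sup>2 = M\<^sup>2 + r\<^sup>2 + 2 * (M * r)"
    by (simp add: power2_eq_square algebra_simps)
  hence "c l + l + (c m + 3 * m) + c M + (c r + F) = E + c m"
    using sq[of l] sq[of r] sq[of M] sq[of N] \<open>N = M + r\<close> unfolding E_def F_def
    by algebra
  hence e: "q ^ c l * q ^ l * (q ^ c m * q ^ (3 * m)) * q ^ c M * (q ^ c r * q ^ F) = q ^ E * q ^ c m"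
    by (simp only: flip: power_add)
  have "quadruple_term ((j, l, m), r) = (- 1) ^ j * (- 1) ^ r * x ^ j * (x\<^sup>2) ^ m * y ^ (2 * M)
      * (q ^ c l * q ^ l * (q ^ c m * q ^ (3 * m)) * q ^ c M * (q ^ c r * q ^ F)) / ?den"
    unfolding quadruple_term_def triple_term_def prod.case qpoch_fps_nth inv_qpoch_fps_nth pc
      M_def[symmetric] F_def power_mult[of q "2 * M + 3" r] power_mult[of q 3 m] minus_minus
      power_minus[of x] power_minus[of "q ^ (2 * M + 3)"] power_mult_distrib
    by (simp add: mult_ac)
  also have "\<dots> = x ^ j * y ^ (2 * j + 2 * l) / (qpoch q q j * qpoch (q\<^sup>2) (q\<^sup>2) l)
     * (- 1) ^ (j + (m + r)) * q ^ E
     * (fps_nth (qpoch_fps (q\<^sup>2) (x\<^sup>2 * y\<^sup>2)) m * fps_nth (inv_qpoch_fps (q\<^sup>2) 1) r)"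
  proof -
    \<comment> \<open>The part (y^2)^m joins (x^2)^m, while the sign of (-x^2 y^2)^m cancels the
      additional (-1)^m in the prefactor.\<close>
    have "y ^ (2 * M) = y ^ (2 * j + 2 * l) * (y\<^sup>2) ^ m"
      by (simp add: M_def algebra_simps flip: power_mult power_add)
    thus ?thesis
      unfolding e qpoch_fps_nth inv_qpoch_fps_nth pc power_one
        power_minus[of "x\<^sup>2 * y\<^sup>2"] power_mult_distrib power_add[of _ j] power_add[of _ m]
      by (simp add: mult_ac)
  qed
  finally show ?thesis
    unfolding E_def N_def c_def .
qed

text \<open>The Cauchy product in m + r = k is evaluated by \<open>q_binomial\<close> in base
  q^2.\<close>

lemma sum_quadruple_term:
  "(\<Sum>m\<le>k. quadruple_term ((j, l, m), k - m))
    = qpoch (x\<^sup>2 * y\<^sup>2) (q\<^sup>2) k * x ^ j * y ^ (2 * j + 2 * l)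
      / (qpoch q q j * qpoch (q\<^sup>2) (q\<^sup>2) k * qpoch (q\<^sup>2) (q\<^sup>2) l)
      * (- 1) ^ (j + k) * q ^ ((j + k + l) * (j + k + l - 1) + l\<^sup>2 + 3 * k)"
proof -
  have "(\<Sum>m\<le>k. quadruple_term ((j, l, m), k - m))
      = x ^ j * y ^ (2 * j + 2 * l) / (qpoch q q j * qpoch (q\<^sup>2) (q\<^sup>2) l)
        * (- 1) ^ (j + k) * q ^ ((j + k + l) * (j + k + l - 1) + l\<^sup>2 + 3 * k)
        * fps_nth (qpoch_fps (q\<^sup>2) (x\<^sup>2 * y\<^sup>2) * inv_qpoch_fps (q\<^sup>2) 1) k"
    unfolding fps_mult_nth sum_distrib_left atLeast0AtMost
    by (intro sum.cong refl) (subst quadruple_term_eq, simp)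
  thus ?thesis
    unfolding q_binomial[OF norm_power2_less_1[OF q]] by (simp add: mult_ac)
qed

end

theorem theorem1p6:
  fixes q x y :: complex
  assumes "norm q < 1"
    and "q \<noteq> 0"
    and "y / q - x * y \<noteq> 0"
  shows "((\<lambda>(j :: nat, k :: nat, l :: nat).
            (qpoch (x\<^sup>2 * y\<^sup>2) (q\<^sup>2) k * x ^ j * y ^ (2 * j + 2 * l))
              / (qpoch q q j * qpoch (q\<^sup>2) (q\<^sup>2) k * qpoch (q\<^sup>2) (q\<^sup>2) l)
            * (- 1) ^ (j + k)
            * q ^ ((j + k + l) * (j + k + l - 1) + l\<^sup>2 + 3 * k))
          has_sum
            (qpoch_inf q (q\<^sup>2) / (2 * (y / q - x * y))
              * (qpoch_inf (x * y) q * qpoch_inf (- y / q) q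
                 - qpoch_inf (- (x * y)) q * qpoch_inf (y / q) q)))
          UNIV"
  (is "(_ has_sum ?S) UNIV")
proof (rule has_sum_SigmaD)
  \<comment> \<open>The substitution r = k - m, exact because m <= k, makes the inner sums finite;
    absolute summability is already contained in the fourfold \<open>has_sum\<close>.\<close>
  show "((\<lambda>((j, k, l), m). quadruple_term q x y ((j, l, m), k - m)) has_sum ?S)
      (Sigma UNIV (\<lambda>(j, k, l). {..k}))"
    using quadruple_term_has_sum[OF assms]
    by (subst has_sum_reindex_bij_witness[where h = "quadruple_term q x y" and T = UNIV
          and j = "\<lambda>((j, k, l), m). ((j, l, m), k - m)" and i = "\<lambda>((j, l, m), r). ((j, m + r, l), m)"])
       auto
qed (auto intro!: has_sum_finiteI simp: sum_quadruple_term[OF assms(1)])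

end
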